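(* Every regular curve in $\mathbb{H}$ has big pieces of intrinsic Lipschitz graphs over horizontal subgroups. That is, if $\gamma\subset\mathbb{H}$ is a regular curve, then there exist constants $c,L>0$ such that for all $p\in\gamma$ and all $0<r\le\operatorname{diam}(\gamma)$ there is an intrinsic $L$-Lipschitz graph $\Gamma\subset\mathbb{H}$ over some one-dimensional horizontal subgroup such that $$\mathcal{H}^1(\gamma\cap\Gamma\cap B(p,r))\ge cr.$$
   Context: The first Heisenberg group $\mathbb{H}$ is $\mathbb{R}^3$ with the group law $(x,y,t)\cdot(x',y',t')=(x+x',y+y',t+t'+\tfrac12(xy'-x'y))$. Write $\|(x,y,t)\|:=\max\{\sqrt{x^2+y^2},\sqrt{|t|}\}$ and $d(p,q):=\|q^{-1}\cdot p\|$ (a metric); metric notions (balls, diameter, Lipschitz maps, Hausdorff measures) are with respect to $d$. Regular curve: a closed set $\gamma\subset\mathbb{H}$ which is the image of a closed subinterval of $\mathbb{R}$ under a Lipschitz map into $(\mathbb{H},d)$, and which is $1$-regular: there is $C\ge1$ such that $C^{-1}r\le\mathcal{H}^1(\gamma\cap B(p,r))\le Cr$ for all $p\in\gamma$ and $0<r\le\operatorname{diam}(\gamma)$. A one-dimensional horizontal subgroup $\mathbb{V}$ is a line through the origin in the $xy$-plane. Let $\mathbb{L}$ be the Euclidean orthogonal complement of $\mathbb{V}$ in the $xy$-plane and $\mathbb{W}=\mathbb{L}\times\{t\text{-axis}\}$. Each $p\in\mathbb{H}$ is uniquely $p=v\cdot w$ with $v\in\mathbb{V}$, $w\in\mathbb{W}$;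 put $\pi_{\mathbb{V}}(p)=v$, $\pi_{\mathbb{W}}(p)=w$. For $\alpha>0$ let $C_{\mathbb{V}}(\alpha)=\{p:\|\pi_{\mathbb{V}}(p)\|\le\alpha\|\pi_{\mathbb{W}}(p)\|\}$. A set $\Gamma\subset\mathbb{H}$ is an intrinsic $L$-Lipschitz graph over $\mathbb{V}$ if $(p\cdot C_{\mathbb{V}}(\alpha))\cap\Gamma=\{p\}$ for all $p\in\Gamma$ and all $0<\alpha<1/L$. *)

theory Defs
  imports "HOL-Analysis.Analysis"
begin

section \<open>The Heisenberg group and its metric\<close>

datatype heis = Heis (xc: real) (yc: real) (tc: real)

text \<open>The group is written additively: the class \<^class>\<open>group_add\<close> does not assume commutativity,
  so \<open>p + q\<close> is the Heisenberg product and \<open>- p\<close> the group inverse.\<close>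

instantiation heis :: group_add
begin

definition "0 = Heis 0 0 0"

definition "p + q = Heis (xc p + xc q) (yc p + yc q)
  (tc p + tc q + (xc p * yc q - xc q * yc p) / 2)"

definition "- p = Heis (- xc p) (- yc p) (- tc p)"

definition minus_heis :: "heis \<Rightarrow> heis \<Rightarrow> heis"
  where "minus_heis p q = p + (- q)"

instance
  by standard
    (simp_all add: zero_heis_def plus_heis_def uminus_heis_def minus_heis_def field_simps)

end

definition heis_norm :: "heis \<Rightarrow> real"
  where "heis_norm p = max (sqrt ((xc p)\<^sup>2 + (yc p)\<^sup>2)) (sqrt \<bar>tc p\<bar>)"

lemma heis_norm_nonneg: "0 \<le> heis_norm p"
  by (simp add: heis_norm_def le_max_iff_disj)

lemma heis_norm_eq_0_iff: "heis_norm p = 0 \<longleftrightarrow> p = 0"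
proof
  assume *: "heis_norm p = 0"
  then have "sqrt ((xc p)\<^sup>2 + (yc p)\<^sup>2) \<le> 0" "sqrt \<bar>tc p\<bar> \<le> 0"
    unfolding heis_norm_def by (metis max.cobounded1, metis max.cobounded2)
  then have "(xc p)\<^sup>2 + (yc p)\<^sup>2 \<le> 0" "\<bar>tc p\<bar> \<le> 0"
    by simp_all
  then have "xc p = 0" "yc p = 0" "tc p = 0"
    by (simp_all add: sum_power2_le_zero_iff)
  then show "p = 0"
    by (simp add: zero_heis_def heis.expand)
qed (simp add: heis_norm_def zero_heis_def)

lemma heis_norm_minus: "heis_norm (- p) = heis_norm p"
  by (simp add: heis_norm_def uminus_heis_def)

lemma heis_norm_triangle: "heis_norm (p + q) \<le> heis_norm p + heis_norm q"
proof -
  define a b where "a = heis_norm p" and "b = heis_norm q"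
  have ab: "a \<ge> 0" "b \<ge> 0"
    by (simp_all add: a_def b_def heis_norm_nonneg)
  have zp: "sqrt ((xc p)\<^sup>2 + (yc p)\<^sup>2) \<le> a" and zq: "sqrt ((xc q)\<^sup>2 + (yc q)\<^sup>2) \<le> b"
    and sp: "sqrt \<bar>tc p\<bar> \<le> a" and sq: "sqrt \<bar>tc q\<bar> \<le> b"
    by (simp_all add: a_def b_def heis_norm_def)
  have tp: "\<bar>tc p\<bar> \<le> a\<^sup>2" and tq: "\<bar>tc q\<bar> \<le> b\<^sup>2"
    using sp sq by (simp_all add: sqrt_le_D)
  have "sqrt ((xc p + xc q)\<^sup>2 + (yc p + yc q)\<^sup>2)
      \<le> sqrt ((xc p)\<^sup>2 + (yc p)\<^sup>2) + sqrt ((xc q)\<^sup>2 + (yc q)\<^sup>2)"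
    by (rule real_sqrt_sum_squares_triangle_ineq)
  then have 1: "sqrt ((xc p + xc q)\<^sup>2 + (yc p + yc q)\<^sup>2) \<le> a + b"
    using zp zq by linarith
  have "(xc p * yc q - xc q * yc p)\<^sup>2 \<le> ((xc p)\<^sup>2 + (yc p)\<^sup>2) * ((xc q)\<^sup>2 + (yc q)\<^sup>2)"
    using zero_le_power2[of "xc p * xc q + yc p * yc q"]
    by (simp add: power2_eq_square algebra_simps)
  also have "\<dots> \<le> a\<^sup>2 * b\<^sup>2"
    using zp zq by (intro mult_mono) (simp_all add: sqrt_le_D)
  finally have "(xc p * yc q - xc q * yc p)\<^sup>2 \<le> (a * b)\<^sup>2"
    by (simp add: power_mult_distrib)
  then have w: "\<bar>xc p * yc q - xc q * yc p\<bar> \<le> a * b"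
    using ab by (metis abs_le_square_iff abs_of_nonneg mult_nonneg_nonneg)
  have ab2: "0 \<le> a * b"
    using ab by simp
  have aux: "\<bar>u + u' + D / 2\<bar> \<le> A + B + 2 * m"
    if "\<bar>u\<bar> \<le> A" "\<bar>u'\<bar> \<le> B" "\<bar>D\<bar> \<le> m" "0 \<le> m" for u u' D A B m :: real
    using that by linarith
  have "\<bar>tc p + tc q + (xc p * yc q - xc q * yc p) / 2\<bar> \<le> a\<^sup>2 + b\<^sup>2 + 2 * (a * b)"
    using tp tq w ab2 aux by blast
  also have "\<dots> = (a + b)\<^sup>2"
    by (simp add: power2_eq_square algebra_simps)
  finally have 2: "sqrt \<bar>tc p + tc q + (xc p * yc q - xc q * yc p) / 2\<bar> \<le> a + b"
    using ab by (simp add: real_le_lsqrt)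
  show ?thesis
    using 1 2 by (simp add: heis_norm_def[of "Heis u v w" for u v w] plus_heis_def flip: a_def b_def)
qed

instantiation heis :: metric_space
begin

definition dist_heis :: "heis \<Rightarrow> heis \<Rightarrow> real"
  where "dist_heis p q = heis_norm (- q + p)"

definition uniformity_heis :: "(heis \<times> heis) filter"
  where "uniformity_heis = (INF e\<in>{0 <..}. principal {(x, y). dist x y < e})"

definition open_heis :: "heis set \<Rightarrow> bool"
  where "open_heis U \<longleftrightarrow> (\<forall>x\<in>U. \<forall>\<^sub>F (x', y) in uniformity. x' = x \<longrightarrow> y \<in> U)"

instance
proof
  fix p q s :: heis
  show "dist p q = 0 \<longleftrightarrow> p = q"
    by (metis dist_heis_def heis_norm_eq_0_iff left_minus add.right_neutral add_minus_cancel)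
  have sym: "dist u v = dist v u" for u v :: heis
    using heis_norm_minus[of "- v + u"] by (simp add: dist_heis_def minus_add)
  have "- q + p = (- q + s) + (- s + p)"
    by (simp add: add.assoc)
  then have "dist p q \<le> dist s q + dist p s"
    unfolding dist_heis_def by (metis heis_norm_triangle)
  then show "dist p q \<le> dist p s + dist q s"
    by (simp add: sym[of s q])
qed (simp_all add: uniformity_heis_def open_heis_def)

end

section \<open>Diameter, one-dimensional Hausdorff measure, regular curves\<close>

text \<open>The library's \<^const>\<open>diameter\<close> is real-valued and unspecified on unbounded sets.  Regular
  curves may be unbounded, so the extended diameter is needed.\<close>

definition ediam :: "'a::metric_space set \<Rightarrow> ennreal"
  where "ediam S = (SUP x\<in>S. SUP y\<in>S. ennreal (dist x y))"

definition hausdorff1_pre :: "real \<Rightarrow> 'a::metric_space set \<Rightarrow> ennreal"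
  where "hausdorff1_pre \<delta> A =
    (INF E\<in>{E :: nat \<Rightarrow> 'a set. A \<subseteq> (\<Union>i. E i) \<and> (\<forall>i. ediam (E i) \<le> ennreal \<delta>)}.
      \<Sum>i. ediam (E i))"

definition hausdorff1 :: "'a::metric_space set \<Rightarrow> ennreal"
  where "hausdorff1 A = (SUP \<delta>\<in>{0<..}. hausdorff1_pre \<delta> A)"

definition one_regular :: "'a::metric_space set \<Rightarrow> bool"
  where "one_regular \<gamma> \<longleftrightarrow>
    (\<exists>C\<ge>1. \<forall>p\<in>\<gamma>. \<forall>r>0. ennreal r \<le> ediam \<gamma> \<longrightarrow>
      ennreal (r / C) \<le> hausdorff1 (\<gamma> \<inter> cball p r) \<and>
      hausdorff1 (\<gamma> \<inter> cball p r) \<le> ennreal (C * r))"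

text \<open>The parameter interval may be unbounded, which is why closedness of the image is a
  separate requirement.\<close>

definition regular_curve :: "heis set \<Rightarrow> bool"
  where "regular_curve \<gamma> \<longleftrightarrow>
    closed \<gamma> \<and>
    (\<exists>(I :: real set) f K. is_interval I \<and> closed I \<and> I \<noteq> {} \<and>
      K-lipschitz_on I f \<and> \<gamma> = f ` I) \<and>
    one_regular \<gamma>"

section \<open>Intrinsic Lipschitz graphs over horizontal subgroups\<close>

definition horizontal_subgroup :: "heis set \<Rightarrow> bool"
  where "horizontal_subgroup V \<longleftrightarrow>
    (\<exists>l :: (real \<times> real) set. subspace l \<and> dim l = 1 \<and> V = {Heis x y 0 | x y. (x, y) \<in> l})"

definition vertical_complement :: "heis set \<Rightarrow> heis set"
  where "vertical_complement V =
    {Heis x y t | x y t. (x, y) \<in> orthogonal_comp {(x', y'). Heis x' y' 0 \<in> V}}"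

definition proj_V :: "heis set \<Rightarrow> heis \<Rightarrow> heis"
  where "proj_V V p = (THE v. v \<in> V \<and> (\<exists>w\<in>vertical_complement V. p = v + w))"

definition proj_W :: "heis set \<Rightarrow> heis \<Rightarrow> heis"
  where "proj_W V p = (THE w. w \<in> vertical_complement V \<and> (\<exists>v\<in>V. p = v + w))"

definition vcone :: "heis set \<Rightarrow> real \<Rightarrow> heis set"
  where "vcone V \<alpha> = {p. heis_norm (proj_V V p) \<le> \<alpha> * heis_norm (proj_W V p)}"

definition intrinsic_lipschitz_graph :: "real \<Rightarrow> heis set \<Rightarrow> heis set \<Rightarrow> bool"
  where "intrinsic_lipschitz_graph L V \<Gamma> \<longleftrightarrow>
    (\<forall>p\<in>\<Gamma>. \<forall>\<alpha>. 0 < \<alpha> \<and> \<alpha> < 1 / L \<longrightarrow> ((+) p ` vcone V \<alpha>) \<inter> \<Gamma> = {p})"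

text \<open>The definite descriptions above are well defined.\<close>

lemma horizontal_decomposition:
  assumes "horizontal_subgroup V"
  shows "\<exists>!(v, w). v \<in> V \<and> w \<in> vertical_complement V \<and> p = v + w"
proof -
  obtain l :: "(real \<times> real) set"
    where l: "subspace l" and V: "V = {Heis x y 0 | x y. (x, y) \<in> l}"
    using assms unfolding horizontal_subgroup_def by blast
  have lV: "{(x', y'). Heis x' y' 0 \<in> V} = l"
    unfolding V by auto
  have W: "vertical_complement V = {Heis x y t | x y t. (x, y) \<in> orthogonal_comp l}"
    unfolding vertical_complement_def lV ..
  obtain a b where a: "a \<in> l" and b: "b \<in> orthogonal_comp l" and ab: "(xc p, yc p) = a + b"
  proof -
    obtain a b where 1: "a \<in> span l" "\<And>w. w \<in> span l \<Longrightarrow> orthogonal b w"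
      and 2: "(xc p, yc p) = a + b"
      using orthogonal_subspace_decomp_exists by metis
    have "span l = l"
      using l by (simp add: span_eq_iff)
    with 1 have "a \<in> l" "b \<in> orthogonal_comp l"
      by (simp_all add: orthogonal_comp_def orthogonal_commute)
    then show ?thesis
      using 2 by (rule that)
  qed
  define v where "v = Heis (fst a) (snd a) 0"
  define w where "w = Heis (fst b) (snd b) (tc p - (fst a * snd b - fst b * snd a) / 2)"
  have "v \<in> V"
    using a unfolding V v_def by auto
  moreover have "w \<in> vertical_complement V"
    using b unfolding W w_def by auto
  moreover have pvw: "p = v + w"
    using ab by (cases a; cases b; cases p) (simp add: v_def w_def plus_heis_def)
  moreover have "v' = v \<and> w' = w"
    if "v' \<in> V" "w' \<in> vertical_complement V" "p = v' + w'" for v' w'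
  proof -
    obtain x y where v': "v' = Heis x y 0" "(x, y) \<in> l"
      using \<open>v' \<in> V\<close> unfolding V by auto
    obtain x1 y1 t1 where w': "w' = Heis x1 y1 t1" "(x1, y1) \<in> orthogonal_comp l"
      using \<open>w' \<in> vertical_complement V\<close> unfolding W by auto
    have eq: "(x, y) + (x1, y1) = a + b"
      using ab \<open>p = v' + w'\<close> v' w' by (simp add: plus_heis_def)
    have "(x, y) - a \<in> l"
      using l v'(2) a by (rule subspace_diff)
    moreover have "(x, y) - a = b - (x1, y1)"
      using eq by (simp add: algebra_simps)
    moreover have "b - (x1, y1) \<in> orthogonal_comp l"
      using subspace_orthogonal_comp b w'(2) by (rule subspace_diff)
    ultimately have "orthogonal ((x, y) - a) ((x, y) - a)"
      unfolding orthogonal_comp_def by simp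
    then have "a = (x, y)"
      by (simp add: orthogonal_self)
    then have "v' = v"
      by (simp add: v'(1) v_def)
    then show ?thesis
      using \<open>p = v' + w'\<close> pvw by (metis add_left_cancel)
  qed
  ultimately show ?thesis
    unfolding Ex1_def split_paired_Ex split_paired_All prod.case prod.inject by blast
qed

end

theory Submission
  imports Defs
begin

text \<open>A set whose projection to a horizontal direction is bilipschitz is an intrinsic Lipschitz graph.
  The given parametrization may retrace itself and be much longer than the curve, so inside a ball
  of radius \<open>r\<close> it is replaced by a limit of shortest \<open>\<epsilon>\<close>-chains of points of \<open>\<gamma>\<close>: non-consecutive
  points of such a chain are \<open>\<epsilon>\<close>-separated, so regularity bounds its length by a multiple of \<open>r\<close>.
  The limit is a 1-Lipschitz curve \<open>F\<close> in \<open>\<gamma>\<close>, of length comparable to \<open>r\<close>, with endpoints at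
  distance comparable to \<open>r\<close>.  If the horizontal projection of \<open>F\<close> stayed too close to its starting
  point, then the \<open>t\<close>-coordinate, which is the area swept by the projection, would be too small for
  the endpoints to be this far apart.  So some horizontal linear function \<open>u\<close> grows along \<open>F\<close> by a
  multiple of \<open>r\<close>, and a rising sun argument for \<open>u \<circ> F\<close> gives a big piece on which \<open>u\<close> is
  bilipschitz.\<close>

section \<open>One-dimensional Hausdorff measure\<close>

lemma dist_le_ediam:
  assumes "x \<in> S" "y \<in> S"
  shows "ennreal (dist x y) \<le> ediam S"
  unfolding ediam_def using assms by (meson SUP_upper2 order_refl)

lemma ediam_empty [simp]: "ediam {} = 0"
  by (simp add: ediam_def bot_ennreal)

lemma hausdorff1_pre_antimono:
  assumes "\<delta> \<le> \<delta>'"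
  shows "hausdorff1_pre \<delta>' A \<le> hausdorff1_pre \<delta> A"
  unfolding hausdorff1_pre_def
  by (rule INF_superset_mono) (use assms in \<open>auto intro: order_trans ennreal_leI\<close>)

lemma hausdorff1_pre_le: "\<delta> > 0 \<Longrightarrow> hausdorff1_pre \<delta> A \<le> hausdorff1 A"
  unfolding hausdorff1_def by (rule SUP_upper) simp

lemma hausdorff1_mono:
  assumes "A \<subseteq> B"
  shows "hausdorff1 A \<le> hausdorff1 B"
  unfolding hausdorff1_def hausdorff1_pre_def
  by (intro SUP_mono' INF_superset_mono) (use assms in auto)

text \<open>A covering set of diameter at most \<delta> < \<sigma> cannot meet both \<open>A\<close>
  and \<open>B\<close>, so every cover of the union splits into a cover of \<open>A\<close> and a
  cover of \<open>B\<close> that share no nonempty set.\<close>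

lemma hausdorff1_pre_add_le:
  assumes sep: "\<And>a b. a \<in> A \<Longrightarrow> b \<in> B \<Longrightarrow> \<sigma> \<le> dist a b" and \<delta>: "0 \<le> \<delta>" "\<delta> < \<sigma>"
  shows "hausdorff1_pre \<delta> A + hausdorff1_pre \<delta> B \<le> hausdorff1_pre \<delta> (A \<union> B)"
  unfolding hausdorff1_pre_def[of \<delta> "A \<union> B"]
proof (rule INF_greatest)
  fix E :: "nat \<Rightarrow> 'a set"
  assume "E \<in> {E. A \<union> B \<subseteq> (\<Union>i. E i) \<and> (\<forall>i. ediam (E i) \<le> ennreal \<delta>)}"
  then have cov: "A \<union> B \<subseteq> (\<Union>i. E i)" and small: "\<And>i. ediam (E i) \<le> ennreal \<delta>"
    by auto
  \<comment> \<open>Sets that miss \<open>X\<close> become empty instead of being dropped: the cover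
    stays indexed by all naturals, and the empty set adds nothing to the sum.\<close>
  define restr where "restr X i = (if E i \<inter> X = {} then {} else E i)" for X i
  have pre: "hausdorff1_pre \<delta> X \<le> (\<Sum>i. ediam (restr X i))" if "X \<subseteq> A \<union> B" for X
    unfolding hausdorff1_pre_def
    by (rule INF_lower) (use that cov small in \<open>auto simp: restr_def; blast\<close>)
  have "ediam (restr A i) + ediam (restr B i) \<le> ediam (E i)" for i
  proof -
    have False if "a \<in> E i" "a \<in> A" "b \<in> E i" "b \<in> B" for a b
    proof -
      have "ennreal (dist a b) \<le> ennreal \<delta>"
        using dist_le_ediam[OF that(1,3)] small[of i] by (rule order_trans)
      moreover have "\<sigma> \<le> dist a b"
        using sep that by blast
      ultimately show False
        using \<delta> by (simp add: ennreal_le_iff)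
    qed
    then show ?thesis
      by (auto simp: restr_def)
  qed
  then have "(\<Sum>i. ediam (restr A i)) + (\<Sum>i. ediam (restr B i)) \<le> (\<Sum>i. ediam (E i))"
    by (subst suminf_add) (auto intro!: suminf_le)
  then show "hausdorff1_pre \<delta> A + hausdorff1_pre \<delta> B \<le> (\<Sum>i. ediam (E i))"
    using add_mono[OF pre[of A] pre[of B]] by (meson Un_upper1 Un_upper2 order_trans)
qed

lemma hausdorff1_add_le:
  assumes sep: "\<And>a b. a \<in> A \<Longrightarrow> b \<in> B \<Longrightarrow> \<sigma> \<le> dist a b" and "\<sigma> > 0"
  shows "hausdorff1 A + hausdorff1 B \<le> hausdorff1 (A \<union> B)"
proof -
  have "hausdorff1_pre \<delta> A + hausdorff1_pre \<delta>' B \<le> hausdorff1 (A \<union> B)"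
    if "\<delta> > 0" "\<delta>' > 0" for \<delta> \<delta>'
  proof -
    \<comment> \<open>A common scale that is finer than both given ones and lies strictly below the
      separation \<sigma>.\<close>
    define m where "m = min (min \<delta> \<delta>') (\<sigma> / 2)"
    have m: "0 < m" "m < \<sigma>" "m \<le> \<delta>" "m \<le> \<delta>'"
      using that assms(2) by (auto simp: m_def)
    have "hausdorff1_pre \<delta> A + hausdorff1_pre \<delta>' B \<le> hausdorff1_pre m A + hausdorff1_pre m B"
      using m by (intro add_mono hausdorff1_pre_antimono)
    also have "\<dots> \<le> hausdorff1_pre m (A \<union> B)"
      using sep m by (intro hausdorff1_pre_add_le[where \<sigma>=\<sigma>]) auto
    also have "\<dots> \<le> hausdorff1 (A \<union> B)"
      using m by (intro hausdorff1_pre_le)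
    finally show ?thesis .
  qed
  moreover have "hausdorff1 A + hausdorff1 B =
      (SUP \<delta>\<in>{0<..}. SUP \<delta>'\<in>{0<..}. hausdorff1_pre \<delta> A + hausdorff1_pre \<delta>' B)"
    unfolding hausdorff1_def
    by (subst ennreal_SUP_add_left[symmetric], simp)
       (subst ennreal_SUP_add_right[symmetric], simp, rule refl)
  ultimately show ?thesis
    by (auto intro!: SUP_least)
qed

lemma sum_hausdorff1_le:
  assumes "finite J" and "\<sigma> > 0"
    and "\<And>i j a b. i \<in> J \<Longrightarrow> j \<in> J \<Longrightarrow> i \<noteq> j \<Longrightarrow> a \<in> A i \<Longrightarrow> b \<in> A j \<Longrightarrow> \<sigma> \<le> dist a b"
  shows "(\<Sum>j\<in>J. hausdorff1 (A j)) \<le> hausdorff1 (\<Union>j\<in>J. A j)"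
  using assms(1,3)
proof (induction J)
  case (insert k J)
  have "(\<Sum>j\<in>insert k J. hausdorff1 (A j)) \<le> hausdorff1 (A k) + hausdorff1 (\<Union>j\<in>J. A j)"
    using insert by (auto intro!: add_mono)
  also have "\<dots> \<le> hausdorff1 (A k \<union> (\<Union>j\<in>J. A j))"
    by (rule hausdorff1_add_le[OF _ assms(2)]) (use insert in blast)
  finally show ?case
    by simp
qed simp

text \<open>Pulling a cover of \<open>A\<close> back along \<open>w\<close> does not increase
  diameters, so it covers \<open>{0..l}\<close> by sets contained in intervals no longer than the
  original diameters. Countable subadditivity of Lebesgue measure concludes.\<close>

lemma hausdorff1_ge_expanding:
  fixes w :: "real \<Rightarrow> 'a::metric_space"
  assumes w: "\<And>y. y \<in> {0..l} \<Longrightarrow> w y \<in> A"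
    and expanding: "\<And>y z. y \<in> {0..l} \<Longrightarrow> z \<in> {0..l} \<Longrightarrow> \<bar>y - z\<bar> \<le> dist (w y) (w z)"
  shows "ennreal l \<le> hausdorff1 A"
proof -
  \<comment> \<open>One scale suffices, because the Hausdorff measure is the supremum over all
    scales; scale 1 makes every covering set have finite diameter.\<close>
  have "ennreal l \<le> hausdorff1_pre 1 A"
    unfolding hausdorff1_pre_def
  proof (rule INF_greatest)
    fix E :: "nat \<Rightarrow> 'a set"
    assume "E \<in> {E. A \<subseteq> (\<Union>i. E i) \<and> (\<forall>i. ediam (E i) \<le> ennreal 1)}"
    then have cov: "A \<subseteq> (\<Union>i. E i)" and small: "\<And>i. ediam (E i) \<le> ennreal 1"
      by auto
    define Y where "Y i = {y \<in> {0..l}. w y \<in> E i}" for i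
    \<comment> \<open>The preimage \<open>Y i\<close> may fail to be measurable, so it is enclosed
      in the interval from its infimum to its supremum.\<close>
    have "\<exists>J. J \<in> sets lborel \<and> Y i \<subseteq> J \<and> emeasure lborel J \<le> ediam (E i)" for i
    proof (cases "Y i = {}")
      case False
      have bdd: "bdd_above (Y i)" "bdd_below (Y i)"
        by (auto simp: Y_def intro!: bdd_aboveI[of _ l] bdd_belowI[of _ 0])
      obtain D where D: "ediam (E i) = ennreal D" "D \<ge> 0"
        using small[of i] by (metis ennreal_cases infinity_ennreal_def neq_top_trans ennreal_neq_top)
      have "y - z \<le> D" if "y \<in> Y i" "z \<in> Y i" for y z
      proof -
        have "\<bar>y - z\<bar> \<le> dist (w y) (w z)"
          using that expanding by (auto simp: Y_def)
        moreover have "ennreal (dist (w y) (w z)) \<le> ennreal D"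
          using that dist_le_ediam[of "w y" "E i" "w z"] D by (auto simp: Y_def)
        ultimately show ?thesis
          using D(2) by (simp add: ennreal_le_iff)
      qed
      then have "Sup (Y i) \<le> z + D" if "z \<in> Y i" for z
        using that False by (intro cSup_least) force+
      then have "Sup (Y i) - D \<le> Inf (Y i)"
        using False by (intro cInf_greatest) force+
      then have "emeasure lborel {Inf (Y i)..Sup (Y i)} \<le> ediam (E i)"
        using False bdd by (auto simp: D cInf_le_cSup intro: ennreal_leI)
      moreover have "Y i \<subseteq> {Inf (Y i)..Sup (Y i)}"
        using bdd by (auto intro: cInf_lower cSup_upper)
      ultimately show ?thesis
        by (intro exI[of _ "{Inf (Y i)..Sup (Y i)}"]) simp
    qed (auto intro!: exI[of _ "{}"])
    then obtain J where J: "\<And>i. J i \<in> sets lborel" "\<And>i. Y i \<subseteq> J i"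
        "\<And>i. emeasure lborel (J i) \<le> ediam (E i)"
      by metis
    have "{0..l} \<subseteq> (\<Union>i. J i)"
      using w cov J(2) by (fastforce simp: Y_def)
    then have "emeasure lborel {0..l} \<le> emeasure lborel (\<Union>i. J i)"
      using J(1) by (intro emeasure_mono) auto
    also have "\<dots> \<le> (\<Sum>i. emeasure lborel (J i))"
      using J(1) by (intro emeasure_subadditive_countably) auto
    also have "\<dots> \<le> (\<Sum>i. ediam (E i))"
      using J(3) by (intro suminf_le) auto
    finally show "ennreal l \<le> (\<Sum>i. ediam (E i))"
      by (cases "0 \<le> l") (auto simp: ennreal_neg)
  qed
  also have "\<dots> \<le> hausdorff1 A"
    by (rule hausdorff1_pre_le) simp
  finally show ?thesis .
qed

section \<open>Shortest chains\<close>

text \<open>Take a chain with the fewest steps among the \<epsilon>-chains in \<open>S\<close> with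
  these endpoints. If two non-consecutive points were within \<epsilon>, jumping directly from one
  to the other would save a step.\<close>

lemma shortest_chain:
  fixes z :: "nat \<Rightarrow> 'a::metric_space"
  assumes "\<And>i. i \<le> m \<Longrightarrow> z i \<in> S" and "\<And>i. i < m \<Longrightarrow> dist (z i) (z (Suc i)) \<le> \<epsilon>"
  obtains x n where "x 0 = z 0" "x n = z m" "\<And>i. i \<le> n \<Longrightarrow> x i \<in> S"
    "\<And>i. i < n \<Longrightarrow> dist (x i) (x (Suc i)) \<le> \<epsilon>"
    "\<And>i j. Suc i < j \<Longrightarrow> j \<le> n \<Longrightarrow> \<epsilon> < dist (x i) (x j)"
proof -
  define chain where "chain n x \<longleftrightarrow> x 0 = z 0 \<and> x n = z m \<and> (\<forall>i\<le>n. x i \<in> S) \<and>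
    (\<forall>i<n. dist (x i) (x (Suc i)) \<le> \<epsilon>)" for n and x :: "nat \<Rightarrow> 'a"
  define n where "n = (LEAST n. \<exists>x. chain n x)"
  have "\<exists>x. chain m x"
    using assms by (auto simp: chain_def)
  then have "\<exists>x. chain n x"
    unfolding n_def by (rule LeastI)
  then obtain x where x: "chain n x" ..
  have min: "n \<le> k" if "chain k y" for k y
    unfolding n_def using that by (intro Least_le) blast
  have "\<epsilon> < dist (x i) (x j)" if "Suc i < j" "j \<le> n" for i j
  proof (rule ccontr)
    assume short: "\<not> \<epsilon> < dist (x i) (x j)"
    define d where "d = j - Suc i"
    have d: "d > 0" "Suc i + d = j"
      using that by (auto simp: d_def)
    \<comment> \<open>This chain omits the \<open>d\<close> points strictly between
      \<open>x i\<close> and \<open>x j\<close>, so that \<open>y (Suc i) = x j\<close>.\<close>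
    define y where "y k = (if k \<le> i then x k else x (k + d))" for k
    have "dist (y k) (y (Suc k)) \<le> \<epsilon>" if "k < n - d" for k
    proof -
      consider "k < i" | "k = i" | "k > i" by linarith
      then show ?thesis
      proof cases
        case 1
        with x d \<open>j \<le> n\<close> show ?thesis by (simp add: y_def chain_def)
      next
        case 2
        with short d show ?thesis by (simp add: y_def)
      next
        case 3
        with x that show ?thesis by (simp add: y_def chain_def)
      qed
    qed
    then have "chain (n - d) y"
      using x d \<open>j \<le> n\<close> by (auto simp: chain_def y_def)
    then have "n \<le> n - d"
      by (rule min)
    then show False
      using d \<open>j \<le> n\<close> by linarith
  qed
  then show ?thesis
    using x that[of x n] by (auto simp: chain_def)
qed

lemma dist_chain_le:
  fixes x :: "nat \<Rightarrow> 'a::metric_space"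
  assumes "\<And>i. i < n \<Longrightarrow> dist (x i) (x (Suc i)) \<le> \<epsilon>" and "i \<le> j" "j \<le> n"
  shows "dist (x i) (x j) \<le> (real j - real i) * \<epsilon>"
  using assms(2,3)
proof (induction j rule: dec_induct)
  case (step j)
  have "dist (x i) (x (Suc j)) \<le> dist (x i) (x j) + dist (x j) (x (Suc j))"
    by (rule dist_triangle)
  also have "\<dots> \<le> (real j - real i) * \<epsilon> + \<epsilon>"
    using step assms(1)[of j] by (intro add_mono) auto
  finally show ?case
    by (simp add: algebra_simps)
qed simp

text \<open>The balls of radius \<open>\<epsilon> / 4\<close> around the points of even index are separated.\<close>

lemma regular_chain_length:
  fixes \<gamma> :: "'a::metric_space set"
  assumes upper: "hausdorff1 (\<gamma> \<inter> cball p r) \<le> ennreal (C * r)"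
    and lower: "\<And>q. q \<in> \<gamma> \<Longrightarrow> ennreal (\<epsilon> / 4 / C) \<le> hausdorff1 (\<gamma> \<inter> cball q (\<epsilon> / 4))"
    and pos: "0 < \<epsilon>" "\<epsilon> \<le> r" "0 < C"
    and x: "\<And>i. i \<le> n \<Longrightarrow> x i \<in> \<gamma> \<inter> cball p (r / 2)"
    and far: "\<And>i j. Suc i < j \<Longrightarrow> j \<le> n \<Longrightarrow> \<epsilon> < dist (x i) (x j)"
  shows "real n * \<epsilon> \<le> 8 * C\<^sup>2 * r"
proof -
  define J where "J = {k. 2 * k \<le> n}"
  have J: "J = {..n div 2}"
    by (auto simp: J_def)
  define A where "A k = \<gamma> \<inter> cball (x (2 * k)) (\<epsilon> / 4)" for k
  have far': "\<epsilon> < dist (x (2 * i)) (x (2 * j))" if "i \<in> J" "j \<in> J" "i \<noteq> j" for i j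
  proof (cases "i < j")
    case True
    with that show ?thesis by (intro far) (auto simp: J_def)
  next
    case False
    with that far[of "2 * j" "2 * i"] show ?thesis
      by (auto simp: J_def dist_commute)
  qed
  have sep: "\<epsilon> / 2 \<le> dist a b" if "i \<in> J" "j \<in> J" "i \<noteq> j" "a \<in> A i" "b \<in> A j" for i j a b
  proof -
    have "dist (x (2 * i)) (x (2 * j)) \<le> dist (x (2 * i)) a + dist a b + dist (x (2 * j)) b"
      by metric
    then show ?thesis
      using far'[OF that(1-3)] that(4,5) by (simp add: A_def)
  qed
  \<comment> \<open>The centres lie within r/2 of \<open>p\<close> and \<epsilon>/4 \<le> r/4, so
    the small balls stay where the upper bound applies.\<close>
  have sub: "A k \<subseteq> \<gamma> \<inter> cball p r" if "k \<in> J" for k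
  proof -
    have "dist p (x (2 * k)) \<le> r / 2"
      using x[of "2 * k"] that by (simp add: J_def)
    then have "dist p q \<le> r" if "dist (x (2 * k)) q \<le> \<epsilon> / 4" for q
      using that pos dist_triangle[of p q "x (2 * k)"] by linarith
    then show ?thesis
      by (auto simp: A_def)
  qed
  \<comment> \<open>Packing: each of the separated small balls carries measure at least
    \<epsilon>/(4C), while all of them together carry at most Cr. At least half of the
    \<open>n\<close> steps are counted by \<open>J\<close>.\<close>
  have "ennreal (real (card J) * (\<epsilon> / 4 / C)) = (\<Sum>k\<in>J. ennreal (\<epsilon> / 4 / C))"
    using pos by (subst ennreal_mult) (simp_all add: ennreal_of_nat_eq_real_of_nat)
  also have "\<dots> \<le> (\<Sum>k\<in>J. hausdorff1 (A k))"
    unfolding A_def by (intro sum_mono lower) (use x in \<open>auto simp: J_def\<close>)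
  also have "\<dots> \<le> hausdorff1 (\<Union>k\<in>J. A k)"
    by (rule sum_hausdorff1_le[where \<sigma> = "\<epsilon> / 2"]) (use pos sep J in auto)
  also have "\<dots> \<le> hausdorff1 (\<gamma> \<inter> cball p r)"
    by (rule hausdorff1_mono) (use sub in blast)
  also note upper
  finally have "real (card J) * (\<epsilon> / 4 / C) \<le> C * r"
    using pos by (simp add: ennreal_le_iff)
  then have "real (card J) * \<epsilon> \<le> 4 * C\<^sup>2 * r"
    using pos by (simp add: field_simps power2_eq_square)
  moreover have "real n \<le> 2 * real (card J)"
    unfolding J by simp
  then have "real n * \<epsilon> \<le> 2 * real (card J) * \<epsilon>"
    using pos by (intro mult_right_mono) auto
  ultimately show ?thesis
    by linarith
qed

section \<open>Limits of chains\<close>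

text \<open>Tychonoff's theorem replaces a diagonal argument: \<open>C\<close> ranges over the sets that are closed in
  the topology of pointwise convergence.\<close>

lemma cluster_function:
  fixes F :: "nat \<Rightarrow> 'b \<Rightarrow> 'a::metric_space"
  assumes "compact K" "\<And>n s. F n s \<in> K"
  obtains G where "\<And>C N. closed C \<Longrightarrow> (\<And>n. n \<ge> N \<Longrightarrow> F n \<in> C) \<Longrightarrow> G \<in> C"
proof -
  have "compactin (product_topology (\<lambda>_. euclidean) UNIV) (PiE (UNIV :: 'b set) (\<lambda>_. K))"
    using assms(1) by (simp add: compactin_PiE)
  then have "compact (PiE (UNIV :: 'b set) (\<lambda>_. K))"
    by (simp add: euclidean_product_topology)
  then have "(PiE UNIV (\<lambda>_. K)) \<inter> (\<Inter>N\<in>UNIV. closure (F ` {N..})) \<noteq> {}"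
  proof (rule compact_imp_fip_image)
    fix I :: "nat set"
    assume "finite I"
    then obtain N where "\<And>n. n \<in> I \<Longrightarrow> n \<le> N"
      by (meson finite_nat_set_iff_bounded_le)
    then have "F N \<in> PiE UNIV (\<lambda>_. K) \<inter> (\<Inter>n\<in>I. closure (F ` {n..}))"
      using assms(2) closure_subset by (fastforce simp: PiE_UNIV_domain)
    then show "PiE UNIV (\<lambda>_. K) \<inter> (\<Inter>n\<in>I. closure (F ` {n..})) \<noteq> {}"
      by blast
  qed simp
  then obtain G where G: "\<And>N. G \<in> closure (F ` {N..})"
    by blast
  show ?thesis
  proof (rule that)
    fix C N
    assume "closed C" "\<And>n. n \<ge> N \<Longrightarrow> F n \<in> C"
    then have "closure (F ` {N..}) \<subseteq> C"
      by (intro closure_minimal) auto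
    then show "G \<in> C"
      using G by blast
  qed
qed

text \<open>Each chain is traversed at unit speed, spending time \<open>\<epsilon> k\<close> on
  every step, and rests at its last point. This gives step functions that are 1-Lipschitz up to an
  error \<open>\<epsilon> k\<close> and have arrived by time \<open>T\<close>; a cluster point of
  them is the limit curve.\<close>

lemma limit_of_chains:
  fixes x :: "nat \<Rightarrow> nat \<Rightarrow> 'a::metric_space"
  assumes K: "compact K" and mem: "\<And>k i. i \<le> n k \<Longrightarrow> x k i \<in> K"
    and start: "\<And>k. x k 0 = p" and fin: "\<And>k. \<rho> \<le> dist p (x k (n k))"
    and step: "\<And>k i. i < n k \<Longrightarrow> dist (x k i) (x k (Suc i)) \<le> \<epsilon> k"
    and \<epsilon>: "\<And>k. 0 < \<epsilon> k" "\<epsilon> \<longlonglongrightarrow> 0"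
    and T: "\<And>k. real (n k) * \<epsilon> k \<le> T"
  obtains G :: "real \<Rightarrow> 'a" where "\<And>s. G s \<in> K" "G 0 = p" "\<rho> \<le> dist p (G T)"
    "\<And>s t. dist (G s) (G t) \<le> \<bar>s - t\<bar>"
proof -
  \<comment> \<open>Negative times are sent to index 0 by \<open>nat\<close>, and \<open>min\<close>
    stops the motion at the end of the chain.\<close>
  define idx where "idx k s = min (n k) (nat \<lfloor>s / \<epsilon> k\<rfloor>)" for k s
  define F where "F k s = x k (idx k s)" for k s
  have FK: "F k s \<in> K" for k s
    unfolding F_def idx_def by (rule mem) simp
  obtain G where G: "\<And>C N. closed C \<Longrightarrow> (\<And>k. k \<ge> N \<Longrightarrow> F k \<in> C) \<Longrightarrow> G \<in> C"
    by (rule cluster_function[of K F, OF K FK]) blast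
  have ev: "continuous_on UNIV (\<lambda>f :: real \<Rightarrow> 'a. f s)" for s
    by (rule continuous_on_product_coordinates)
  have le: "dist (F k s) (F k t) \<le> \<bar>s - t\<bar> + \<epsilon> k" if "s \<le> t" for k s t
  proof -
    have mono: "nat \<lfloor>s / \<epsilon> k\<rfloor> \<le> nat \<lfloor>t / \<epsilon> k\<rfloor>"
      using that \<epsilon>(1)[of k] by (intro nat_mono floor_mono divide_right_mono) auto
    have "dist (F k s) (F k t) \<le> (real (idx k t) - real (idx k s)) * \<epsilon> k"
      unfolding F_def using mono by (intro dist_chain_le[where n = "n k"] step) (auto simp: idx_def)
    \<comment> \<open>Rounding down both times costs at most one extra step, which becomes the error
      \<open>\<epsilon> k\<close>.\<close>
    also have "real (idx k t) - real (idx k s) \<le> t / \<epsilon> k - s / \<epsilon> k + 1"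
    proof -
      have a: "real (idx k t) - real (idx k s) \<le> real (nat \<lfloor>t / \<epsilon> k\<rfloor>) - real (nat \<lfloor>s / \<epsilon> k\<rfloor>)"
        using mono by (auto simp: idx_def min_def)
      have b: "s / \<epsilon> k \<le> t / \<epsilon> k"
        using that \<epsilon>(1)[of k] by (intro divide_right_mono) auto
      have "real (nat \<lfloor>v\<rfloor>) - real (nat \<lfloor>u\<rfloor>) \<le> v - u + 1" if "u \<le> v" for u v :: real
        using that by linarith
      from a this[OF b] show ?thesis by linarith
    qed
    also have "(t / \<epsilon> k - s / \<epsilon> k + 1) * \<epsilon> k = \<bar>s - t\<bar> + \<epsilon> k"
      using \<epsilon>(1)[of k] that by (simp add: field_simps)
    finally show ?thesis
      using \<epsilon>(1)[of k] by (simp add: mult_right_mono)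
  qed
  have lip: "dist (G s) (G t) \<le> \<bar>s - t\<bar>" for s t
  proof (rule field_le_epsilon)
    fix e :: real
    assume "e > 0"
    then obtain N where N: "\<And>k. k \<ge> N \<Longrightarrow> \<epsilon> k < e"
      using order_tendstoD(2)[OF \<epsilon>(2)] by (auto simp: eventually_sequentially)
    \<comment> \<open>The slack \<open>e\<close> makes the condition hold for all late
      \<open>k\<close>, and it is closed under pointwise convergence, so it passes to
      \<open>G\<close>.\<close>
    have "G \<in> {f. dist (f s) (f t) \<le> \<bar>s - t\<bar> + e}"
    proof (rule G)
      show "closed {f :: real \<Rightarrow> 'a. dist (f s) (f t) \<le> \<bar>s - t\<bar> + e}"
        by (intro closed_Collect_le continuous_on_dist continuous_on_const ev)
    next
      fix k
      assume "k \<ge> N"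
      then have "\<epsilon> k < e" by (rule N)
      then show "F k \<in> {f. dist (f s) (f t) \<le> \<bar>s - t\<bar> + e}"
        using le[of s t k] le[of t s k] by (cases "s \<le> t") (auto simp: dist_commute)
    qed
    then show "dist (G s) (G t) \<le> \<bar>s - t\<bar> + e"
      by simp
  qed
  have "G \<in> {f. f s \<in> K}" for s
  proof (rule G)
    have "closed ((\<lambda>f :: real \<Rightarrow> 'a. f s) -` K)"
      using compact_imp_closed[OF K] ev[of s] by (rule closed_vimage)
    then show "closed {f :: real \<Rightarrow> 'a. f s \<in> K}"
      by (simp add: vimage_def)
  qed (use FK in auto)
  moreover have "G \<in> {f. f 0 = p}"
  proof (rule G)
    show "closed {f :: real \<Rightarrow> 'a. f 0 = p}"
      by (intro closed_Collect_eq continuous_on_const ev)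
  qed (auto simp: F_def idx_def start)
  moreover have "G \<in> {f. \<rho> \<le> dist p (f T)}"
  proof (rule G)
    show "closed {f :: real \<Rightarrow> 'a. \<rho> \<le> dist p (f T)}"
      by (intro closed_Collect_le continuous_on_dist continuous_on_const ev)
  next
    fix k
    have "real (n k) \<le> T / \<epsilon> k"
      using T[of k] \<epsilon>(1)[of k] by (simp add: field_simps)
    then have "idx k T = n k"
      unfolding idx_def by (simp add: le_nat_floor min_absorb1)
    then show "F k \<in> {f. \<rho> \<le> dist p (f T)}"
      using fin by (simp add: F_def)
  qed
  ultimately show ?thesis
    using that[of G] lip by auto
qed


section \<open>Arcs of controlled length inside a ball\<close>

text \<open>Sample \<open>f\<close> at equally spaced parameters, cut the resulting chain when it
  first reaches distance \<rho> from its start, and only then shorten it. Shortening inside the ball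
  keeps the chain where regularity can bound its length.\<close>

lemma short_chain:
  fixes f :: "real \<Rightarrow> 'a::metric_space"
  assumes lip: "L-lipschitz_on (closed_segment a b) f"
    and \<rho>: "0 \<le> \<rho>" "\<rho> < dist (f a) (f b)" and "\<epsilon> > 0"
  obtains x n where "x 0 = f a" "\<rho> \<le> dist (f a) (x n)"
    "\<And>i. i \<le> n \<Longrightarrow> x i \<in> f ` closed_segment a b \<inter> cball (f a) (\<rho> + \<epsilon>)"
    "\<And>i. i < n \<Longrightarrow> dist (x i) (x (Suc i)) \<le> \<epsilon>"
    "\<And>i j. Suc i < j \<Longrightarrow> j \<le> n \<Longrightarrow> \<epsilon> < dist (x i) (x j)"
proof -
  \<comment> \<open>So many subdivisions that the Lipschitz bound makes every step at most
    \<epsilon>.\<close>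
  obtain m where m: "L * \<bar>b - a\<bar> < real m * \<epsilon>"
    using reals_Archimedean3[OF \<open>\<epsilon> > 0\<close>] by blast
  moreover have L: "0 \<le> L"
    using lip by (rule lipschitz_on_nonneg)
  ultimately have "m > 0"
    by (metis abs_ge_zero less_le_not_le mult_nonneg_nonneg mult_zero_left neq0_conv of_nat_0)
  define pt where "pt i = a + (real i / real m) * (b - a)" for i
  define z where "z i = f (pt i)" for i
  have seg: "pt i \<in> closed_segment a b" if "i \<le> m" for i
    unfolding closed_segment_def pt_def using that \<open>m > 0\<close>
    by (auto intro!: exI[of _ "real i / real m"] simp: field_simps)
  have z0: "z 0 = f a" and zm: "z m = f b"
    using \<open>m > 0\<close> by (simp_all add: z_def pt_def)
  have step: "dist (z i) (z (Suc i)) \<le> \<epsilon>" if "i < m" for i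
  proof -
    have "dist (z i) (z (Suc i)) \<le> L * dist (pt i) (pt (Suc i))"
      unfolding z_def using that by (intro lipschitz_onD[OF lip] seg) auto
    also have "pt (Suc i) - pt i = (b - a) / real m"
      unfolding pt_def by (simp add: add_divide_distrib algebra_simps)
    then have "dist (pt i) (pt (Suc i)) = \<bar>b - a\<bar> / real m"
      by (metis abs_divide abs_of_nat dist_commute dist_real_def)
    also have "L * (\<bar>b - a\<bar> / real m) \<le> \<epsilon>"
      using m \<open>m > 0\<close> by (simp add: field_simps)
    finally show ?thesis .
  qed
  \<comment> \<open>All earlier points are closer than \<rho>, so the point of index
    \<open>N\<close> overshoots by at most one step, that is, by at most \<epsilon>.\<close>
  define N where "N = (LEAST i. \<rho> \<le> dist (f a) (z i))"
  have m': "\<rho> \<le> dist (f a) (z m)"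
    using \<rho> zm by simp
  have N: "\<rho> \<le> dist (f a) (z N)" "N \<le> m"
    unfolding N_def using m' by (rule LeastI, rule Least_le)
  have before: "dist (f a) (z i) < \<rho>" if "i < N" for i
    using not_less_Least[OF that[unfolded N_def]] by simp
  have near: "dist (f a) (z i) \<le> \<rho> + \<epsilon>" if "i \<le> N" for i
  proof (cases i)
    case 0
    with z0 \<rho> \<open>\<epsilon> > 0\<close> show ?thesis by simp
  next
    case (Suc j)
    then show ?thesis
      using before[of j] step[of j] dist_triangle[of "f a" "z i" "z j"] that \<open>N \<le> m\<close> by simp
  qed
  have "z i \<in> f ` closed_segment a b \<inter> cball (f a) (\<rho> + \<epsilon>)" if "i \<le> N" for i
    using that near[of i] seg[of i] N(2) by (auto simp: z_def)
  moreover have "dist (z i) (z (Suc i)) \<le> \<epsilon>" if "i < N" for i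
    using that N(2) by (intro step) simp
  ultimately show ?thesis
  proof (rule shortest_chain)
    fix x n
    assume *: "x 0 = z 0" "x n = z N"
      "\<And>i. i \<le> n \<Longrightarrow> x i \<in> f ` closed_segment a b \<inter> cball (f a) (\<rho> + \<epsilon>)"
      "\<And>i. i < n \<Longrightarrow> dist (x i) (x (Suc i)) \<le> \<epsilon>"
      "\<And>i j. Suc i < j \<Longrightarrow> j \<le> n \<Longrightarrow> \<epsilon> < dist (x i) (x j)"
    have "x 0 = f a" "\<rho> \<le> dist (f a) (x n)"
      using *(1,2) z0 N(1) by simp_all
    then show ?thesis
      using *(3-5) by (rule that)
  qed
qed

text \<open>For \<epsilon> tending to 0, the chains from \<open>short_chain\<close> with \<rho> =
  r/3 have length at most \<open>8 * C\<^sup>2 * r\<close> by \<open>regular_chain_length\<close>.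
  This bound serves as the common arrival time in \<open>limit_of_chains\<close>.\<close>

lemma regular_arc:
  fixes \<gamma> :: "'a::metric_space set" and f :: "real \<Rightarrow> 'a"
  assumes I: "is_interval I" and lip: "L-lipschitz_on I f" and \<gamma>: "\<gamma> = f ` I" and "C \<ge> 1"
    and reg: "\<And>p r. p \<in> \<gamma> \<Longrightarrow> r > 0 \<Longrightarrow> ennreal r \<le> ediam \<gamma> \<Longrightarrow>
      ennreal (r / C) \<le> hausdorff1 (\<gamma> \<inter> cball p r) \<and> hausdorff1 (\<gamma> \<inter> cball p r) \<le> ennreal (C * r)"
    and p: "p \<in> \<gamma>" and r: "0 < r" "ennreal r \<le> ediam \<gamma>"
  obtains G :: "real \<Rightarrow> 'a" where "\<And>s. G s \<in> \<gamma> \<inter> cball p r" "G 0 = p"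
    "r / 3 \<le> dist p (G (8 * C\<^sup>2 * r))" "\<And>s t. dist (G s) (G t) \<le> \<bar>s - t\<bar>"
proof -
  \<comment> \<open>Otherwise the diameter of \<gamma> would be at most 2r/3, which is less than
    r.\<close>
  have "\<exists>q\<in>\<gamma>. r / 3 < dist p q"
  proof (rule ccontr)
    assume "\<not> ?thesis"
    then have near: "dist p q \<le> r / 3" if "q \<in> \<gamma>" for q
      using that by force
    have "dist x y \<le> 2 * r / 3" if "x \<in> \<gamma>" "y \<in> \<gamma>" for x y
      using near[OF that(1)] near[OF that(2)] dist_triangle3[of x y p] by linarith
    then have "ediam \<gamma> \<le> ennreal (2 * r / 3)"
      unfolding ediam_def by (intro SUP_least ennreal_leI)
    with r(2) have "ennreal r \<le> ennreal (2 * r / 3)"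
      by (rule order_trans)
    with r(1) show False
      by (simp add: ennreal_le_iff)
  qed
  then obtain a b where ab: "a \<in> I" "b \<in> I" "p = f a" "r / 3 < dist (f a) (f b)"
    using p \<gamma> by auto
  have seg: "closed_segment a b \<subseteq> I"
    using I ab by (simp add: closed_segment_subset is_interval_convex)
  have lip': "L-lipschitz_on (closed_segment a b) f"
    using lip seg by (rule lipschitz_on_subset)
  \<comment> \<open>The parameter segment is compact even when \<open>I\<close> is unbounded, which
    makes \<open>K\<close> compact.\<close>
  define K where "K = f ` closed_segment a b \<inter> cball p (r / 2)"
  have "compact K"
    unfolding K_def using lip'
    by (intro compact_Int_closed compact_continuous_image lipschitz_on_continuous_on) auto
  have K\<gamma>: "K \<subseteq> \<gamma> \<inter> cball p (r / 2)"
    using seg \<gamma> by (auto simp: K_def)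
  \<comment> \<open>With \<epsilon> at most r/6, the radius r/3 + \<epsilon> of
    \<open>short_chain\<close> is at most r/2, as \<open>regular_chain_length\<close>
    requires.\<close>
  define \<epsilon> where "\<epsilon> k = r / 6 / real (Suc k)" for k
  have \<epsilon>0: "0 < \<epsilon> k" and \<epsilon>6: "\<epsilon> k \<le> r / 6" for k
    using r(1) by (auto simp: \<epsilon>_def field_simps)
  have "\<epsilon> \<longlonglongrightarrow> 0"
    unfolding \<epsilon>_def by (rule LIMSEQ_Suc[OF lim_const_over_n])
  have "\<exists>n x. x 0 = p \<and> r / 3 \<le> dist p (x n) \<and> (\<forall>i\<le>n. x i \<in> K) \<and>
      (\<forall>i<n. dist (x i) (x (Suc i)) \<le> \<epsilon> k) \<and> real n * \<epsilon> k \<le> 8 * C\<^sup>2 * r" for k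
  proof (rule short_chain[where f = f and a = a and b = b, OF lip' _ ab(4) \<epsilon>0[of k]])
    fix x n
    assume x: "x 0 = f a" "r / 3 \<le> dist (f a) (x n)"
      "\<And>i. i \<le> n \<Longrightarrow> x i \<in> f ` closed_segment a b \<inter> cball (f a) (r / 3 + \<epsilon> k)"
      "\<And>i. i < n \<Longrightarrow> dist (x i) (x (Suc i)) \<le> \<epsilon> k"
      "\<And>i j. Suc i < j \<Longrightarrow> j \<le> n \<Longrightarrow> \<epsilon> k < dist (x i) (x j)"
    have xK: "x i \<in> K" if "i \<le> n" for i
      using x(3)[OF that] \<epsilon>6[of k] ab(3) by (auto simp: K_def)
    have "real n * \<epsilon> k \<le> 8 * C\<^sup>2 * r"
    proof (rule regular_chain_length[where \<gamma> = \<gamma> and p = p and x = x])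
      show "hausdorff1 (\<gamma> \<inter> cball p r) \<le> ennreal (C * r)"
        using reg[OF p r] by simp
      show "ennreal (\<epsilon> k / 4 / C) \<le> hausdorff1 (\<gamma> \<inter> cball q (\<epsilon> k / 4))" if "q \<in> \<gamma>" for q
      proof -
        have "ennreal (\<epsilon> k / 4) \<le> ennreal r"
          using \<epsilon>6[of k] \<epsilon>0[of k] by (intro ennreal_leI) linarith
        then show ?thesis
          using reg[OF that, of "\<epsilon> k / 4"] \<epsilon>0[of k] r(2) by (auto intro: order_trans)
      qed
      show "\<epsilon> k \<le> r"
        using \<epsilon>6[of k] r(1) by linarith
      show "x i \<in> \<gamma> \<inter> cball p (r / 2)" if "i \<le> n" for i
        using xK[OF that] K\<gamma> by blast
    qed (use \<epsilon>0[of k] \<open>C \<ge> 1\<close> x(5) in auto)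
    then show ?thesis
      using x xK ab(3) by blast
  qed (use r(1) in simp)
  then obtain n x where nx: "\<And>k. x k 0 = p" "\<And>k. r / 3 \<le> dist p (x k (n k))"
    "\<And>k i. i \<le> n k \<Longrightarrow> x k i \<in> K" "\<And>k i. i < n k \<Longrightarrow> dist (x k i) (x k (Suc i)) \<le> \<epsilon> k"
    "\<And>k. real (n k) * \<epsilon> k \<le> 8 * C\<^sup>2 * r"
    by metis
  obtain G where G: "\<And>s. G s \<in> K" "G 0 = p" "r / 3 \<le> dist p (G (8 * C\<^sup>2 * r))"
      "\<And>s t. dist (G s) (G t) \<le> \<bar>s - t\<bar>"
    using limit_of_chains[OF \<open>compact K\<close> nx(3,1,2,4) \<epsilon>0 \<open>\<epsilon> \<longlonglongrightarrow> 0\<close> nx(5)] by blast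
  moreover have "K \<subseteq> \<gamma> \<inter> cball p r"
    using K\<gamma> r(1) by (auto simp: subset_iff)
  ultimately show ?thesis
    using that[of G] by blast
qed

section \<open>Bilipschitz pieces\<close>

text \<open>The set of times where \<open>b\<close> is at most \<open>y\<close> is compact, and its
  maximum is the required time.\<close>

lemma last_time:
  fixes b :: "real \<Rightarrow> real"
  assumes cont: "continuous_on {0..S} b" and "0 \<le> S" and y: "b 0 \<le> y" "y \<le> b S"
  obtains s where "s \<in> {0..S}" "b s = y" "\<And>t. t \<in> {s..S} \<Longrightarrow> y \<le> b t"
proof -
  define A where "A = {0..S} \<inter> b -` {..y}"
  have "closed A"
    unfolding A_def using cont by (intro continuous_closed_preimage) auto
  then have "compact A"
    unfolding A_def by (metis compact_Icc compact_Int_closed inf.left_idem)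
  moreover have "0 \<in> A"
    using assms by (auto simp: A_def)
  ultimately obtain s where s: "s \<in> A" "\<And>t. t \<in> A \<Longrightarrow> t \<le> s"
    using compact_attains_sup[of A] by blast
  then have sS: "0 \<le> s" "s \<le> S" "b s \<le> y"
    by (auto simp: A_def)
  have "continuous_on {s..S} b"
    using cont by (rule continuous_on_subset) (use sS in auto)
  \<comment> \<open>A time after \<open>s\<close> with value \<open>y\<close> would belong to
    \<open>A\<close>, so the intermediate value found here can only be at \<open>s\<close>
    itself.\<close>
  then obtain t where t: "s \<le> t" "t \<le> S" "b t = y"
    using IVT'[of b s y S] sS y by auto
  then have "t = s"
    using s(2)[of t] sS by (force simp: A_def)
  have "y \<le> b u" if "u \<in> {s..S}" for u
    using s(2)[of u] that sS t \<open>t = s\<close> by (cases "u = s") (force simp: A_def)+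
  then show ?thesis
    using that[of s] sS t \<open>t = s\<close> by auto
qed

text \<open>\<open>\<Gamma>\<close> consists of the points \<open>F s\<close> where \<open>s\<close> is the last time at which
  \<open>b t = u (F t) - u (F 0) - \<eta> * t\<close> takes its current value.  On these times \<open>b\<close> is increasing,
  so \<open>u \<circ> F\<close> grows at least at rate \<open>\<eta>\<close>, and they exhaust the values in \<open>{0..b S}\<close>.\<close>

lemma bilipschitz_piece:
  fixes F :: "real \<Rightarrow> 'a::metric_space" and u :: "'a \<Rightarrow> real"
  assumes F: "\<And>s t. dist (F s) (F t) \<le> \<bar>s - t\<bar>" and u: "\<And>p q. \<bar>u p - u q\<bar> \<le> dist p q"
    and "0 \<le> S" "0 \<le> \<eta>"
  obtains \<Gamma> where "\<Gamma> \<subseteq> F ` {0..S}" "\<And>p q. p \<in> \<Gamma> \<Longrightarrow> q \<in> \<Gamma> \<Longrightarrow> \<eta> * dist p q \<le> \<bar>u p - u q\<bar>"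
    "ennreal (u (F S) - u (F 0) - \<eta> * S) \<le> hausdorff1 \<Gamma>"
proof -
  define b where "b s = u (F s) - u (F 0) - \<eta> * s" for s
  have "1-lipschitz_on {0..S} (\<lambda>s. u (F s))"
    using order_trans[OF u F] by (intro lipschitz_onI) (auto simp: dist_real_def)
  then have cont: "continuous_on {0..S} b"
    unfolding b_def by (intro continuous_intros lipschitz_on_continuous_on)
  have "\<exists>s. s \<in> {0..S} \<and> b s = y \<and> (\<forall>t\<in>{s..S}. y \<le> b t)" if "y \<in> {0..b S}" for y
  proof -
    have "b 0 \<le> y" "y \<le> b S"
      using that by (auto simp: b_def)
    then obtain s where "s \<in> {0..S}" "b s = y" "\<And>t. t \<in> {s..S} \<Longrightarrow> y \<le> b t"
      using last_time[OF cont \<open>0 \<le> S\<close>] by metis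
    then show ?thesis
      by blast
  qed
  then obtain \<sigma> where \<sigma>: "\<And>y. y \<in> {0..b S} \<Longrightarrow> \<sigma> y \<in> {0..S}" "\<And>y. y \<in> {0..b S} \<Longrightarrow> b (\<sigma> y) = y"
      "\<And>y t. y \<in> {0..b S} \<Longrightarrow> t \<in> {\<sigma> y..S} \<Longrightarrow> y \<le> b t"
    by metis
  have key: "z - y \<le> u (F (\<sigma> z)) - u (F (\<sigma> y)) \<and>
      \<eta> * dist (F (\<sigma> y)) (F (\<sigma> z)) \<le> u (F (\<sigma> z)) - u (F (\<sigma> y))"
    if "y \<in> {0..b S}" "z \<in> {0..b S}" "y \<le> z" for y z
  proof -
    \<comment> \<open>After the last time with value \<open>z\<close> the function \<open>b\<close>
      stays at or above \<open>z\<close>, so a lower value cannot occur later.\<close>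
    have "\<sigma> y \<le> \<sigma> z"
    proof (rule ccontr)
      assume less: "\<not> \<sigma> y \<le> \<sigma> z"
      then have "z \<le> b (\<sigma> y)"
        using \<sigma>(1)[OF that(1)] \<sigma>(3)[OF that(2)] by auto
      with that \<sigma>(2) have "y = z"
        by fastforce
      with less show False by simp
    qed
    \<comment> \<open>Both summands are nonnegative. The first gives the expansion used for the
      measure; the second gives the lower bound in terms of distance, because \<open>F\<close> is
      1-Lipschitz.\<close>
    moreover have "u (F (\<sigma> z)) - u (F (\<sigma> y)) = z - y + \<eta> * (\<sigma> z - \<sigma> y)"
      using \<sigma>(2)[OF that(1)] \<sigma>(2)[OF that(2)] by (simp add: b_def algebra_simps)
    moreover have "\<eta> * dist (F (\<sigma> y)) (F (\<sigma> z)) \<le> \<eta> * (\<sigma> z - \<sigma> y)"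
      using F[of "\<sigma> y" "\<sigma> z"] \<open>0 \<le> \<eta>\<close> calculation(1) by (intro mult_left_mono) auto
    moreover have "0 \<le> \<eta> * (\<sigma> z - \<sigma> y)"
      using calculation(1) \<open>0 \<le> \<eta>\<close> by simp
    ultimately show ?thesis
      using that(3) by linarith
  qed
  show ?thesis
  proof (rule that)
    show "(F \<circ> \<sigma>) ` {0..b S} \<subseteq> F ` {0..S}"
      using \<sigma>(1) by auto
  next
    fix p q
    assume "p \<in> (F \<circ> \<sigma>) ` {0..b S}" "q \<in> (F \<circ> \<sigma>) ` {0..b S}"
    then obtain y z where yz: "y \<in> {0..b S}" "z \<in> {0..b S}" "p = F (\<sigma> y)" "q = F (\<sigma> z)"
      by auto
    show "\<eta> * dist p q \<le> \<bar>u p - u q\<bar>"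
      using key[OF yz(1,2)] key[OF yz(2,1)] yz by (cases "y \<le> z") (auto simp: dist_commute)
  next
    have "\<bar>y - z\<bar> \<le> dist (F (\<sigma> y)) (F (\<sigma> z))" if "y \<in> {0..b S}" "z \<in> {0..b S}" for y z
      using key[OF that] key[OF that(2,1)] u[of "F (\<sigma> y)" "F (\<sigma> z)"] by (cases "y \<le> z") auto
    then have "ennreal (b S) \<le> hausdorff1 ((F \<circ> \<sigma>) ` {0..b S})"
      by (intro hausdorff1_ge_expanding[where w = "F \<circ> \<sigma>"]) auto
    then show "ennreal (u (F S) - u (F 0) - \<eta> * S) \<le> hausdorff1 ((F \<circ> \<sigma>) ` {0..b S})"
      by (simp add: b_def)
  qed
qed

section \<open>Horizontal displacement\<close>

definition hproj :: "heis \<Rightarrow> real \<times> real"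
  where "hproj p = (xc p, yc p)"

lemma hproj_minus_add: "hproj (- p + q) = hproj q - hproj p"
  by (simp add: hproj_def plus_heis_def uminus_heis_def)

lemma heis_norm_eq: "heis_norm p = max (norm (hproj p)) (sqrt \<bar>tc p\<bar>)"
  by (simp add: heis_norm_def hproj_def norm_Pair)

lemma norm_hproj_le: "norm (hproj p) \<le> heis_norm p"
  by (simp add: heis_norm_eq)

lemma norm_hproj_diff_le: "norm (hproj p - hproj q) \<le> dist p q"
  using norm_hproj_le[of "- q + p"] by (simp add: dist_heis_def hproj_minus_add)

lemma abs_tc_le: "\<bar>tc p\<bar> \<le> (heis_norm p)\<^sup>2"
  by (rule sqrt_le_D) (simp add: heis_norm_eq)

text \<open>Cauchy-Schwarz for the area form in the group law.\<close>

lemma abs_tc_add_le: "\<bar>tc (p + q)\<bar> \<le> \<bar>tc p\<bar> + \<bar>tc q\<bar> + norm (hproj p) * norm (hproj q) / 2"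
proof -
  \<comment> \<open>Lagrange's identity: the two sides differ by the square of the inner
    product.\<close>
  have "(xc p * yc q - xc q * yc p)\<^sup>2 \<le> ((xc p)\<^sup>2 + (yc p)\<^sup>2) * ((xc q)\<^sup>2 + (yc q)\<^sup>2)"
    using zero_le_power2[of "xc p * xc q + yc p * yc q"]
    by (simp add: power2_eq_square algebra_simps)
  then have "\<bar>xc p * yc q - xc q * yc p\<bar> \<le> norm (hproj p) * norm (hproj q)"
    by (simp add: hproj_def norm_Pair real_le_rsqrt flip: real_sqrt_mult)
  then show ?thesis
    using abs_triangle_ineq[of "tc p + tc q" "(xc p * yc q - xc q * yc p) / 2"]
      abs_triangle_ineq[of "tc p" "tc q"]
    by (simp add: plus_heis_def)
qed

text \<open>A discrete swept-area estimate. Each step contributes its own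
  \<open>t\<close>-coordinate, at most \<open>\<epsilon>\<^sup>2\<close>, and half the area form of
  the horizontal displacement so far with the new step, at most \<rho>\<epsilon>/2.\<close>

lemma abs_tc_chain_le:
  fixes x :: "nat \<Rightarrow> heis"
  assumes step: "\<And>i. i < n \<Longrightarrow> dist (x i) (x (Suc i)) \<le> \<epsilon>"
    and flat: "\<And>i. i \<le> n \<Longrightarrow> norm (hproj (x i) - hproj (x 0)) \<le> \<rho>"
  shows "\<bar>tc (- x 0 + x n)\<bar> \<le> real n * (\<epsilon>\<^sup>2 + \<rho> * \<epsilon> / 2)"
  using assms
proof (induction n)
  case 0
  then show ?case by (simp add: zero_heis_def)
next
  case (Suc n)
  define w where "w = - x n + x (Suc n)"
  have w: "heis_norm w \<le> \<epsilon>"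
    using Suc.prems(1)[of n] by (simp add: w_def dist_commute flip: dist_heis_def)
  have "- x 0 + x (Suc n) = (- x 0 + x n) + w"
    by (simp add: w_def add.assoc)
  then have "\<bar>tc (- x 0 + x (Suc n))\<bar> \<le> \<bar>tc (- x 0 + x n)\<bar> + \<bar>tc w\<bar>
      + norm (hproj (- x 0 + x n)) * norm (hproj w) / 2"
    using abs_tc_add_le[of "- x 0 + x n" w] by simp
  moreover have "\<bar>tc w\<bar> \<le> \<epsilon>\<^sup>2"
    using abs_tc_le[of w] power_mono[OF w heis_norm_nonneg, of 2] by linarith
  moreover have "norm (hproj (- x 0 + x n)) * norm (hproj w) \<le> \<rho> * \<epsilon>"
  proof (rule mult_mono)
    show le: "norm (hproj (- x 0 + x n)) \<le> \<rho>"
      using Suc.prems(2)[of n] by (simp add: hproj_minus_add)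
    show "0 \<le> \<rho>"
      using le by (rule order_trans[OF norm_ge_zero])
  qed (use w norm_hproj_le[of w] in auto)
  moreover have "\<bar>tc (- x 0 + x n)\<bar> \<le> real n * (\<epsilon>\<^sup>2 + \<rho> * \<epsilon> / 2)"
    using Suc by simp
  moreover have "real (Suc n) * (\<epsilon>\<^sup>2 + \<rho> * \<epsilon> / 2) = real n * (\<epsilon>\<^sup>2 + \<rho> * \<epsilon> / 2) + \<epsilon>\<^sup>2 + \<rho> * \<epsilon> / 2"
    by (simp add: algebra_simps)
  ultimately show ?case
    by linarith
qed

text \<open>Divide the time interval into \<open>n\<close> equal steps and apply
  \<open>abs_tc_chain_le\<close>. The steps' own \<open>t\<close>-coordinates add up to at most
  \<open>T\<^sup>2 / n\<close>, which vanishes in the limit and leaves only the area term.\<close>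

lemma flat_curve_dist_le:
  fixes F :: "real \<Rightarrow> heis"
  assumes F: "\<And>s t. dist (F s) (F t) \<le> \<bar>s - t\<bar>" and "0 \<le> T"
    and flat: "\<And>s. s \<in> {0..T} \<Longrightarrow> norm (hproj (F s) - hproj (F 0)) \<le> \<rho>"
  shows "(dist (F 0) (F T))\<^sup>2 \<le> max (\<rho>\<^sup>2) (T * \<rho> / 2)"
proof -
  define w where "w = - F 0 + F T"
  have "\<bar>tc w\<bar> \<le> T\<^sup>2 / real n + T * \<rho> / 2" if "n > 0" for n :: nat
  proof -
    define x where "x i = F (real i * (T / real n))" for i
    have "dist (x i) (x (Suc i)) \<le> T / real n" for i
      using F[of "real i * (T / real n)" "real (Suc i) * (T / real n)"] \<open>0 \<le> T\<close> that
      by (simp add: x_def dist_commute flip: left_diff_distrib)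
        (simp add: field_simps)
    moreover have "norm (hproj (x i) - hproj (x 0)) \<le> \<rho>" if "i \<le> n" for i
    proof -
      have "real i * (T / real n) \<le> T"
        using \<open>n > 0\<close> \<open>0 \<le> T\<close> that by (simp add: field_simps mult_left_mono)
      then show ?thesis
        using flat[of "real i * (T / real n)"] \<open>0 \<le> T\<close> by (simp add: x_def)
    qed
    ultimately have "\<bar>tc (- x 0 + x n)\<bar> \<le> real n * ((T / real n)\<^sup>2 + \<rho> * (T / real n) / 2)"
      by (rule abs_tc_chain_le)
    also have "\<dots> = T\<^sup>2 / real n + T * \<rho> / 2"
      using that by (simp add: field_simps power2_eq_square)
    finally show ?thesis
      using that by (simp add: x_def w_def)
  qed
  then have "eventually (\<lambda>n. \<bar>tc w\<bar> \<le> T\<^sup>2 / real n + T * \<rho> / 2) sequentially"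
    using eventually_gt_at_top by (rule eventually_mono[rotated])
  moreover have "(\<lambda>n. T\<^sup>2 / real n + T * \<rho> / 2) \<longlonglongrightarrow> 0 + T * \<rho> / 2"
    by (intro tendsto_intros lim_const_over_n)
  ultimately have "\<bar>tc w\<bar> \<le> T * \<rho> / 2"
    using tendsto_lowerbound[OF _ _ sequentially_bot] by force
  moreover have "norm (hproj w) \<le> \<rho>"
    using flat[of T] \<open>0 \<le> T\<close> by (simp add: w_def hproj_minus_add)
  then have "(norm (hproj w))\<^sup>2 \<le> \<rho>\<^sup>2"
    by (simp add: power_mono)
  moreover have "dist (F 0) (F T) = heis_norm w"
    by (simp add: w_def dist_commute flip: dist_heis_def)
  ultimately show ?thesis
    unfolding heis_norm_eq by (simp add: max_def)
qed

section \<open>Intrinsic Lipschitz graphs\<close>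

text \<open>Take for \<open>V\<close> the line spanned by \<open>e\<close>. Let \<open>z\<close> in
  the cone be the displacement between two points of \<Gamma>, with \<open>V\<close>-part of norm a.
  Then \<open>z\<close> has norm at most a/\<eta> and its \<open>W\<close>-part at most a +
  a/\<eta>. The cone condition gives a \<le> \<alpha>(1 + 1/\<eta>)a, and \<alpha>(1 + 1/\<eta>) < 1
  forces a = 0, hence \<open>z = 0\<close>.\<close>

lemma intrinsic_lipschitz_graphI:
  fixes e :: "real \<times> real"
  assumes e: "norm e = 1" and "0 < \<eta>"
    and \<Gamma>: "\<And>p q. p \<in> \<Gamma> \<Longrightarrow> q \<in> \<Gamma> \<Longrightarrow> \<eta> * dist p q \<le> \<bar>hproj p \<bullet> e - hproj q \<bullet> e\<bar>"
  obtains V where "horizontal_subgroup V" "intrinsic_lipschitz_graph (1 + 1 / \<eta>) V \<Gamma>"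
proof -
  define V where "V = {Heis x y 0 | x y. (x, y) \<in> span {e}}"
  have "e \<noteq> 0"
    using e by auto
  then have "dim {e} = 1"
    using dim_eq_card_independent[of "{e}"] by simp
  then have "dim (span {e}) = 1"
    by (simp only: dim_span)
  then have V: "horizontal_subgroup V"
    unfolding horizontal_subgroup_def V_def by (intro exI[of _ "span {e}"]) auto
  have W: "vertical_complement V = {Heis x y t | x y t. (x, y) \<in> orthogonal_comp (span {e})}"
    unfolding vertical_complement_def V_def by simp
  \<comment> \<open>The \<open>V\<close>-part has no \<open>t\<close>-coordinate and the
    \<open>W\<close>-part is horizontally orthogonal to \<open>e\<close>, so the norm of the
    \<open>V\<close>-part is the size of the \<open>e\<close>-component of \<open>z\<close>.\<close>
  have "proj_V V z + proj_W V z = z \<and> heis_norm (proj_V V z) = \<bar>hproj z \<bullet> e\<bar>" for z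
  proof -
    obtain v w where vw: "v \<in> V" "w \<in> vertical_complement V" "z = v + w"
      and uniq: "\<And>v' w'. v' \<in> V \<Longrightarrow> w' \<in> vertical_complement V \<Longrightarrow> z = v' + w' \<Longrightarrow> v' = v \<and> w' = w"
      using horizontal_decomposition[OF V, of z]
      unfolding Ex1_def split_paired_Ex split_paired_All prod.case prod.inject by metis
    have pV: "proj_V V z = v"
      unfolding proj_V_def by (rule the_equality) (use vw uniq in blast)+
    have pW: "proj_W V z = w"
      unfolding proj_W_def by (rule the_equality) (use vw uniq in blast)+
    have "hproj v \<in> span {e}" and tv: "tc v = 0"
      using vw(1) by (auto simp: V_def hproj_def)
    then obtain k where k: "hproj v = k *\<^sub>R e"
      unfolding span_singleton by blast
    have "orthogonal (hproj w) e"
      using vw(2) by (auto simp: W hproj_def orthogonal_comp_def span_base orthogonal_commute)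
    moreover have "hproj z = hproj v + hproj w"
      using vw(3) by (simp add: hproj_def plus_heis_def)
    moreover have "e \<bullet> e = 1"
      using e by (simp add: norm_eq_1)
    ultimately have hz: "hproj z \<bullet> e = k"
      by (simp add: k orthogonal_def inner_add_left inner_scaleR_left)
    have "heis_norm v = \<bar>k\<bar>"
      using e by (simp add: heis_norm_eq k tv)
    then show ?thesis
      unfolding pV pW hz using vw(3) by simp
  qed
  then have decomp: "proj_V V z + proj_W V z = z"
    and norm_V: "heis_norm (proj_V V z) = \<bar>hproj z \<bullet> e\<bar>" for z
    by auto
  have "(+) p ` vcone V \<alpha> \<inter> \<Gamma> = {p}" if "p \<in> \<Gamma>" and \<alpha>: "0 < \<alpha>" "\<alpha> < 1 / (1 + 1 / \<eta>)" for p \<alpha>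
  proof -
    have "z = 0" if z: "z \<in> vcone V \<alpha>" "p + z \<in> \<Gamma>" for z
    proof -
      let ?a = "\<bar>hproj z \<bullet> e\<bar>"
      have "dist (p + z) p = heis_norm z"
        by (simp add: dist_heis_def)
      moreover have "hproj (p + z) = hproj p + hproj z"
        by (simp add: hproj_def plus_heis_def)
      ultimately have "\<eta> * heis_norm z \<le> ?a"
        using \<Gamma>[OF z(2) \<open>p \<in> \<Gamma>\<close>] by (simp add: inner_add_left)
      then have nz: "heis_norm z \<le> ?a / \<eta>"
        using \<open>0 < \<eta>\<close> by (simp add: field_simps)
      have "proj_W V z = - proj_V V z + z"
        using decomp[of z] by (metis minus_add_cancel)
      then have "heis_norm (proj_W V z) \<le> ?a + heis_norm z"
        using heis_norm_triangle[of "- proj_V V z" z] norm_V[of z] by (simp add: heis_norm_minus)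
      then have "?a \<le> \<alpha> * (?a + ?a / \<eta>)"
        using z(1) nz norm_V[of z] \<alpha>(1) unfolding vcone_def
        by (smt (verit) mem_Collect_eq mult_left_mono)
      also have "\<dots> = (\<alpha> * (1 + 1 / \<eta>)) * ?a"
        by (simp add: algebra_simps)
      finally have "?a \<le> (\<alpha> * (1 + 1 / \<eta>)) * ?a" .
      moreover have "0 < 1 + 1 / \<eta>"
        using \<open>0 < \<eta>\<close> by (simp add: add_pos_pos)
      then have "\<alpha> * (1 + 1 / \<eta>) < 1"
        using \<alpha>(2) by (simp only: pos_less_divide_eq)
      ultimately have "\<not> 0 < ?a"
        using mult_strict_right_mono[of "\<alpha> * (1 + 1 / \<eta>)" 1 ?a] by linarith
      then have "heis_norm z = 0"
        using nz heis_norm_nonneg[of z] by simp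
      then show ?thesis
        by (simp only: heis_norm_eq_0_iff)
    qed
    moreover have "0 \<in> vcone V \<alpha>"
    proof -
      have "heis_norm (proj_V V 0) = 0"
        unfolding norm_V by (simp add: hproj_def zero_heis_def flip: zero_prod_def)
      then show ?thesis
        using \<alpha>(1) by (simp add: vcone_def heis_norm_nonneg)
    qed
    then have "p \<in> (+) p ` vcone V \<alpha>"
      by (rule rev_image_eqI) simp
    ultimately show ?thesis
      using \<open>p \<in> \<Gamma>\<close> by fastforce
  qed
  then show ?thesis
    using V by (intro that[of V]) (auto simp: intrinsic_lipschitz_graph_def)
qed

section \<open>Choice of the constants and construction of the big piece\<close>

theorem theorem1p12:
  fixes \<gamma> :: "heis set"
  assumes "regular_curve \<gamma>"
  shows "\<exists>(c::real) (L::real). c > 0 \<and> L > 0 \<and>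
    (\<forall>p\<in>\<gamma>. \<forall>r::real. 0 < r \<and> ennreal r \<le> ediam \<gamma> \<longrightarrow>
      (\<exists>\<Gamma> V. horizontal_subgroup V \<and> intrinsic_lipschitz_graph L V \<Gamma> \<and>
        hausdorff1 (\<gamma> \<inter> \<Gamma> \<inter> cball p r) \<ge> ennreal (c * r)))"
proof -
  obtain I :: "real set" and f K C where I: "is_interval I" "K-lipschitz_on I f" "\<gamma> = f ` I"
    and C: "C \<ge> 1"
    and reg: "\<And>p r. p \<in> \<gamma> \<Longrightarrow> r > 0 \<Longrightarrow> ennreal r \<le> ediam \<gamma> \<Longrightarrow>
      ennreal (r / C) \<le> hausdorff1 (\<gamma> \<inter> cball p r) \<and> hausdorff1 (\<gamma> \<inter> cball p r) \<le> ennreal (C * r)"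
    using assms unfolding regular_curve_def one_regular_def by blast
  \<comment> \<open>With T = \<open>8 * C\<^sup>2 * r\<close>, this \<open>c\<close> makes the area
    term for horizontal displacement 2cr equal to \<open>r\<^sup>2 / 18\<close>, below the square of
    r/3. The slope \<eta> is such that \<eta>T = cr, so the rising sun argument loses at most half
    of that displacement.\<close>
  define c where "c = 1 / (144 * C\<^sup>2)"
  define \<eta> where "\<eta> = c / (8 * C\<^sup>2)"
  have pos: "0 < c" "0 < \<eta>"
    using C by (auto simp: c_def \<eta>_def)
  have cC: "8 * C\<^sup>2 * c = 1 / 18"
    using C by (simp add: c_def)
  have "c \<le> 1 / 144"
    using C by (simp add: c_def field_simps one_le_power)
  have "\<exists>\<Gamma> V. horizontal_subgroup V \<and> intrinsic_lipschitz_graph (1 + 1 / \<eta>) V \<Gamma> \<and>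
        hausdorff1 (\<gamma> \<inter> \<Gamma> \<inter> cball p r) \<ge> ennreal (c * r)"
    if p: "p \<in> \<gamma>" and r: "0 < r" "ennreal r \<le> ediam \<gamma>" for p r
  proof -
    define T where "T = 8 * C\<^sup>2 * r"
    have T: "0 \<le> T" "\<eta> * T = c * r" "T * c = r / 18"
      using r C cC by (simp_all add: T_def \<eta>_def)
    obtain F :: "real \<Rightarrow> heis" where F: "\<And>s. F s \<in> \<gamma> \<inter> cball p r" "F 0 = p" "r / 3 \<le> dist p (F T)"
        "\<And>s t. dist (F s) (F t) \<le> \<bar>s - t\<bar>"
      using regular_arc[OF I C reg p r] unfolding T_def by blast
    \<comment> \<open>Otherwise \<open>flat_curve_dist_le\<close> puts the endpoints of
      \<open>F\<close> closer together than r/3.\<close>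
    have "\<exists>S\<in>{0..T}. 2 * c * r < norm (hproj (F S) - hproj (F 0))"
    proof (rule ccontr)
      assume "\<not> ?thesis"
      then have "(dist (F 0) (F T))\<^sup>2 \<le> max ((2 * c * r)\<^sup>2) (T * (2 * c * r) / 2)"
        by (intro flat_curve_dist_le F(4) T(1)) force
      also have "T * (2 * c * r) / 2 = r\<^sup>2 / 18"
        using T(3) by (simp add: power2_eq_square)
      finally have sq: "(dist (F 0) (F T))\<^sup>2 \<le> max ((2 * c * r)\<^sup>2) (r\<^sup>2 / 18)" .
      have "(2 * c * r)\<^sup>2 \<le> (r / 72)\<^sup>2"
        using r(1) pos(1) \<open>c \<le> 1 / 144\<close> by (intro power_mono) auto
      then have "(2 * c * r)\<^sup>2 \<le> r\<^sup>2 / 18"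
        by (rule order_trans) (simp add: power_divide)
      with sq have "(dist (F 0) (F T))\<^sup>2 \<le> r\<^sup>2 / 18"
        by simp
      also have "\<dots> < (r / 3)\<^sup>2"
        using r(1) by (simp add: power_divide)
      also have "\<dots> \<le> (dist (F 0) (F T))\<^sup>2"
        using F(2,3) r(1) by (intro power_mono) auto
      finally show False by simp
    qed
    then obtain S where S: "0 \<le> S" "S \<le> T" "2 * c * r < norm (hproj (F S) - hproj (F 0))"
      by auto
    define d where "d = hproj (F S) - hproj (F 0)"
    \<comment> \<open>In the direction of the displacement itself, the linear function grows by the
      full norm of \<open>d\<close>.\<close>
    define e where "e = (1 / norm d) *\<^sub>R d"
    have "0 < 2 * c * r"
      using pos(1) r(1) by simp
    with S(3) have "0 < norm d"
      unfolding d_def by linarith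
    then have e: "norm e = 1" and de: "d \<bullet> e = norm d"
      by (simp_all add: e_def dot_square_norm power2_eq_square)
    have u: "\<bar>hproj q \<bullet> e - hproj q' \<bullet> e\<bar> \<le> dist q q'" for q q'
      using Cauchy_Schwarz_ineq2[of "hproj q - hproj q'" e] norm_hproj_diff_le[of q q'] e
      by (simp add: inner_diff_left)
    obtain \<Gamma> where \<Gamma>: "\<Gamma> \<subseteq> F ` {0..S}"
        "\<And>q q'. q \<in> \<Gamma> \<Longrightarrow> q' \<in> \<Gamma> \<Longrightarrow> \<eta> * dist q q' \<le> \<bar>hproj q \<bullet> e - hproj q' \<bullet> e\<bar>"
        "ennreal (hproj (F S) \<bullet> e - hproj (F 0) \<bullet> e - \<eta> * S) \<le> hausdorff1 \<Gamma>"
      using bilipschitz_piece[OF F(4) u S(1) less_imp_le[OF pos(2)]] by blast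
    obtain V where V: "horizontal_subgroup V" "intrinsic_lipschitz_graph (1 + 1 / \<eta>) V \<Gamma>"
      using intrinsic_lipschitz_graphI[OF e pos(2) \<Gamma>(2)] by blast
    have "\<eta> * S \<le> c * r"
      using S(2) pos(2) T(2) by (metis less_imp_le mult_left_mono)
    moreover have "hproj (F S) \<bullet> e - hproj (F 0) \<bullet> e = norm d"
      using de by (simp add: d_def inner_diff_left)
    ultimately have "c * r \<le> hproj (F S) \<bullet> e - hproj (F 0) \<bullet> e - \<eta> * S"
      using S(3) by (simp add: d_def)
    then have "ennreal (c * r) \<le> hausdorff1 \<Gamma>"
      using \<Gamma>(3) by (meson ennreal_leI order_trans)
    \<comment> \<open>The whole curve \<open>F\<close> already runs inside \<gamma> and the ball, so
      intersecting loses nothing.\<close>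
    moreover have "\<gamma> \<inter> \<Gamma> \<inter> cball p r = \<Gamma>"
      using \<Gamma>(1) F(1) by blast
    ultimately show ?thesis
      using V by (intro exI[of _ \<Gamma>] exI[of _ V]) simp
  qed
  moreover have "0 < 1 + 1 / \<eta>"
    using pos(2) by (simp add: add_pos_pos)
  ultimately show ?thesis
    using pos(1) by (intro exI[of _ c] exI[of _ "1 + 1 / \<eta>"]) simp
qed

end
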